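(* Let $k\ge 2$ be an integer and let $G$ be a graph with $e(G)=k$. Then $G$ has constant balancing number if and only if $G\in\mathcal{C}_k$ when $k$ is even, and $G - e\in\mathcal{C}_{k-1}$ for some $e\in E(G)$ when $k$ is odd.
   Context: For a graph $G$ with $e(G)$ edges, a $2$-edge-coloring (red/blue) of $K_n$ contains a balanced copy of $G$ if there is a subgraph of $K_n$ isomorphic to $G$ in which one of the colors is assigned to exactly $\lfloor e(G)/2\rfloor$ of its edges. $\mathrm{bal}(n,G)$ is the minimum integer $m$ such that every $2$-edge-coloring of $K_n$ with more than $m$ edges in each color contains a balanced copy of $G$ ($\infty$ if none exists). $G$ has constant balancing number if there is a constant $c(G)$ depending only on $G$ with $\mathrm{bal}(n,G)\le c(G)$ for all sufficiently large $n$. For a positive even integer $k$, $\mathcal{C}_k$ is the family of graphs $H$ with (i) $e(H)=k$, (ii) $\beta(H)\ge k/2$, where $\beta(H)$ is the matching number (maximum number of pairwise non-incident edges), and (iii) a vertex $x$ with $\deg_H(x)=k/2$. *)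

theory Defs
  imports Complex_Main "HOL-Library.Ramsey" "HOL-Library.Extended_Nat"
begin

text \<open>
  Graphs are finite and simple: a pair of a finite vertex set and a set of two-element
  sets of vertices.  Isolated vertices are permitted.
\<close>

type_synonym 'a graph = "'a set \<times> 'a set set"

definition verts :: "'a graph \<Rightarrow> 'a set" where
  "verts G = fst G"

definition edges :: "'a graph \<Rightarrow> 'a set set" where
  "edges G = snd G"

definition fin_graph :: "'a graph \<Rightarrow> bool" where
  "fin_graph G \<longleftrightarrow> finite (verts G) \<and> edges G \<subseteq> [verts G]\<^bsup>2\<^esup>"

definition num_edges :: "'a graph \<Rightarrow> nat" where
  "num_edges G = card (edges G)"

definition degree :: "'a graph \<Rightarrow> 'a \<Rightarrow> nat" where
  "degree G x = card {e \<in> edges G. x \<in> e}"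

definition del_edge :: "'a graph \<Rightarrow> 'a set \<Rightarrow> 'a graph" where
  "del_edge G e = (verts G, edges G - {e})"

definition subgraph :: "'a graph \<Rightarrow> 'a graph \<Rightarrow> bool" where
  "subgraph H G \<longleftrightarrow> fin_graph H \<and> verts H \<subseteq> verts G \<and> edges H \<subseteq> edges G"

definition graph_iso :: "'a graph \<Rightarrow> 'b graph \<Rightarrow> bool" where
  "graph_iso G H \<longleftrightarrow>
     (\<exists>f. bij_betw f (verts G) (verts H) \<and> edges H = (\<lambda>e. f ` e) ` edges G)"

definition matching :: "'a graph \<Rightarrow> 'a set set \<Rightarrow> bool" where
  "matching G M \<longleftrightarrow> M \<subseteq> edges G \<and> pairwise disjnt M"

definition matching_number :: "'a graph \<Rightarrow> nat" where
  "matching_number G = Max {card M | M. matching G M}"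

definition complete_graph :: "nat \<Rightarrow> nat graph" where
  "complete_graph n = ({..<n}, [{..<n}]\<^bsup>2\<^esup>)"

datatype color = Red | Blue

text \<open>
  A 2-edge-coloring of the complete graph is a function on all sets of naturals; only its
  values on the edges of the graph in question are ever used.
\<close>

definition color_class :: "(nat set \<Rightarrow> color) \<Rightarrow> nat graph \<Rightarrow> color \<Rightarrow> nat set set" where
  "color_class c H a = {e \<in> edges H. c e = a}"

definition has_balanced_copy :: "nat \<Rightarrow> (nat set \<Rightarrow> color) \<Rightarrow> 'a graph \<Rightarrow> bool" where
  "has_balanced_copy n c G \<longleftrightarrow>
     (\<exists>H. subgraph H (complete_graph n) \<and> graph_iso G H \<and>
          (\<exists>a. card (color_class c H a) = num_edges G div 2))"

text \<open>
  The infimum in the extended naturals is the minimum if the set is nonempty, and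
  infinity otherwise.  No m with 2 * m at least the number of edges of the complete graph
  leaves more than m edges for both colors, so such an m belongs to the set vacuously.
  This does not affect whether the values are bounded by a constant for large n.
\<close>

definition bal :: "nat \<Rightarrow> 'a graph \<Rightarrow> enat" where
  "bal n G =
     Inf (enat ` {m. \<forall>c. (\<forall>a. card (color_class c (complete_graph n) a) > m)
                        \<longrightarrow> has_balanced_copy n c G})"

definition constant_balancing_number :: "'a graph \<Rightarrow> bool" where
  "constant_balancing_number G \<longleftrightarrow> (\<exists>c. \<exists>N. \<forall>n\<ge>N. bal n G \<le> enat c)"

text \<open>The family is only meaningful for positive even k.\<close>

definition family_C :: "nat \<Rightarrow> 'a graph set" where
  "family_C k = {H. fin_graph H \<and> num_edges H = k \<and> matching_number H \<ge> k div 2 \<and>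
                    (\<exists>x\<in>verts H. degree H x = k div 2)}"

end

theory Submission
  imports Defs
begin

text \<open>
  Necessity: a balanced copy under the colouring with a red full star forces a vertex of degree
  \<open>m\<close> or \<open>k - m\<close>, where \<open>m = k div 2\<close>, and under the colouring with a long red matching it
  forces \<open>m\<close> disjoint edges.

  Sufficiency: it is enough to find, in some colour, a monochromatic clique together with a
  vertex joined to it in the other colour (send the vertex of degree \<open>m\<close> there), or a large
  matching of one colour inside a clique of the other (send the \<open>m\<close> disjoint edges there).
  Many edges of one colour contain a large star or a large matching of that colour, and Ramsey's
  theorem then yields one of the two patterns or a large clique of the same colour.  If
  large cliques of both colours exist, some vertex of one of them has many neighbours in the
  other clique, joined to it in the wrong colour, which is the first pattern again.
\<close>

section \<open>Balanced copies as embeddings\<close>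

lemma fin_graphD:
  assumes "fin_graph G"
  shows "finite (verts G)" "finite (edges G)" "edges G \<subseteq> [verts G]\<^bsup>2\<^esup>" "edges G \<subseteq> Pow (verts G)"
proof -
  show V: "finite (verts G)" and E: "edges G \<subseteq> [verts G]\<^bsup>2\<^esup>"
    using assms by (auto simp: fin_graph_def)
  show P: "edges G \<subseteq> Pow (verts G)"
    using E by (auto simp: nsets_def)
  show "finite (edges G)"
    using P V by (meson finite_Pow_iff finite_subset)
qed

lemma inj_on_image_edges:
  assumes "fin_graph G" and "inj_on f (verts G)"
  shows "inj_on ((`) f) (edges G)"
  using inj_on_image_Pow[OF assms(2)] fin_graphD(4)[OF assms(1)] by (rule inj_on_subset)

lemma card_color_class_image:
  assumes "fin_graph G" and "inj_on f (verts G)" and "edges H = (\<lambda>e. f ` e) ` edges G"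
  shows "card (color_class c H a) = card {e \<in> edges G. c (f ` e) = a}"
proof -
  have "color_class c H a = (\<lambda>e. f ` e) ` {e \<in> edges G. c (f ` e) = a}"
    using assms(3) by (auto simp: color_class_def)
  moreover have "inj_on (\<lambda>e. f ` e) {e \<in> edges G. c (f ` e) = a}"
    using inj_on_image_edges[OF assms(1,2)] by (rule inj_on_subset) auto
  ultimately show ?thesis
    by (simp add: card_image)
qed

lemma image_in_nsets2:
  assumes "e \<in> [V]\<^bsup>2\<^esup>" and "inj_on f V"
  shows "f ` e \<in> [f ` V]\<^bsup>2\<^esup>"
  using assms by (auto simp: nsets_def card_image inj_on_subset)

text \<open>The image of \<open>G\<close> under an injection \<open>f\<close> is the copy
  \<open>H\<close>. Distinct edges have distinct images, so colours can be counted on the edges of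
  \<open>G\<close> itself.\<close>

lemma has_balanced_copy_iff:
  assumes "fin_graph G"
  shows "has_balanced_copy n c G \<longleftrightarrow>
    (\<exists>f a. inj_on f (verts G) \<and> f ` verts G \<subseteq> {..<n} \<and>
           card {e \<in> edges G. c (f ` e) = a} = num_edges G div 2)"
proof
  assume "has_balanced_copy n c G"
  then obtain H a f where H: "subgraph H (complete_graph n)" "bij_betw f (verts G) (verts H)"
      "edges H = (\<lambda>e. f ` e) ` edges G" "card (color_class c H a) = num_edges G div 2"
    by (auto simp: has_balanced_copy_def graph_iso_def)
  have "inj_on f (verts G)" "f ` verts G \<subseteq> {..<n}"
    using H(1,2) by (auto simp: bij_betw_def subgraph_def complete_graph_def verts_def)
  then show "\<exists>f a. inj_on f (verts G) \<and> f ` verts G \<subseteq> {..<n} \<and>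
           card {e \<in> edges G. c (f ` e) = a} = num_edges G div 2"
    using H(3,4) card_color_class_image[OF assms] by metis
next
  assume "\<exists>f a. inj_on f (verts G) \<and> f ` verts G \<subseteq> {..<n} \<and>
           card {e \<in> edges G. c (f ` e) = a} = num_edges G div 2"
  then obtain f a where f: "inj_on f (verts G)" "f ` verts G \<subseteq> {..<n}"
      "card {e \<in> edges G. c (f ` e) = a} = num_edges G div 2"
    by blast
  define H where "H = (f ` verts G, (\<lambda>e. f ` e) ` edges G)"
  have H: "verts H = f ` verts G" "edges H = (\<lambda>e. f ` e) ` edges G"
    by (simp_all add: H_def verts_def edges_def)
  have "edges H \<subseteq> [verts H]\<^bsup>2\<^esup>"
    using fin_graphD(3)[OF assms] image_in_nsets2[OF _ f(1)] H by auto
  moreover have "[verts H]\<^bsup>2\<^esup> \<subseteq> [{..<n}]\<^bsup>2\<^esup>"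
    using f(2) H(1) by (simp add: nsets_mono)
  ultimately have "subgraph H (complete_graph n)"
    using fin_graphD(1)[OF assms] f(2) H
    by (auto simp: subgraph_def fin_graph_def complete_graph_def verts_def edges_def)
  moreover have "graph_iso G H"
    using f(1) H by (auto simp: graph_iso_def bij_betw_def)
  moreover have "card (color_class c H a) = num_edges G div 2"
    using card_color_class_image[OF assms f(1) H(2)] f(3) by simp
  ultimately show "has_balanced_copy n c G"
    unfolding has_balanced_copy_def by blast
qed

section \<open>Upper bounds on the balancing number and lower bounds on the matching number\<close>

text \<open>The set whose infimum is taken is upward closed, so a bound on the infimum amounts to
  membership of \<open>d\<close>.\<close>

lemma bal_le_iff:
  "bal n G \<le> enat d \<longleftrightarrow>
    (\<forall>c. (\<forall>a. d < card (color_class c (complete_graph n) a)) \<longrightarrow> has_balanced_copy n c G)"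
    (is "_ \<longleftrightarrow> ?R")
proof
  assume "bal n G \<le> enat d"
  \<comment> \<open>A strict bound on an infimum provides an actual member of the set below
    it.\<close>
  then have "bal n G < enat (Suc d)"
    by (metis enat_ord_simps(2) lessI order_le_less_trans)
  then obtain m where "m < Suc d"
      "\<forall>c. (\<forall>a. m < card (color_class c (complete_graph n) a)) \<longrightarrow> has_balanced_copy n c G"
    unfolding bal_def Inf_less_iff by auto
  then show ?R
    by (meson less_Suc_eq_le order_le_less_trans)
next
  assume ?R
  then show "bal n G \<le> enat d"
    unfolding bal_def by (intro Inf_lower) auto
qed

lemma matching_number_ge_iff:
  assumes "fin_graph G"
  shows "m \<le> matching_number G \<longleftrightarrow> (\<exists>M. matching G M \<and> card M = m)"
proof -
  have fin: "finite {card M | M. matching G M}"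
    using fin_graphD(2)[OF assms] by (simp add: matching_def)
  have ne: "{card M | M. matching G M} \<noteq> {}"
    by (auto simp: matching_def intro!: exI[of _ "{}"])
  show ?thesis
  proof
    assume "m \<le> matching_number G"
    then obtain M where M: "matching G M" "m \<le> card M"
      using Max_in[OF fin ne] by (auto simp: matching_number_def)
    then obtain M' where "M' \<subseteq> M" "card M' = m"
      by (meson obtain_subset_with_card_n)
    with M show "\<exists>M. matching G M \<and> card M = m"
      by (auto simp: matching_def intro: pairwise_subset)
  next
    assume "\<exists>M. matching G M \<and> card M = m"
    then show "m \<le> matching_number G"
      unfolding matching_number_def using fin by (auto intro!: Max_ge)
  qed
qed

lemma card_color_compl:
  fixes c :: "'b \<Rightarrow> color"
  assumes "finite E"
  shows "card {e \<in> E. c e = Red} + card {e \<in> E. c e = Blue} = card E"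
proof -
  have "{e \<in> E. c e = Red} \<union> {e \<in> E. c e = Blue} = E"
    using color.exhaust by auto
  moreover have "card ({e \<in> E. c e = Red} \<union> {e \<in> E. c e = Blue}) =
      card {e \<in> E. c e = Red} + card {e \<in> E. c e = Blue}"
    using assms by (intro card_Un_disjoint) auto
  ultimately show ?thesis
    by simp
qed

text \<open>For odd \<open>k\<close> the colour of the edge left out of \<open>F\<close> is irrelevant: the other colour
  still has exactly \<open>m\<close> edges.\<close>
lemma has_balanced_copyI:
  assumes G: "fin_graph G" and F: "F \<subseteq> edges G" "card F = 2 * m" and m: "num_edges G div 2 = m"
    and f: "inj_on f (verts G)" "f ` verts G \<subseteq> {..<n}"
    and col: "card {e \<in> F. c (f ` e) = a} = m"
  shows "has_balanced_copy n c G"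
proof -
  have finE: "finite (edges G)" and finF: "finite F"
    using fin_graphD(2)[OF G] F(1) by (auto intro: finite_subset)
  have ge: "m \<le> card {e \<in> edges G. c (f ` e) = b}" for b
  proof -
    have "card {e \<in> F. c (f ` e) = b} = m"
      using card_color_compl[OF finF, of "\<lambda>e. c (f ` e)"] col F(2) by (cases a; cases b) auto
    moreover have "card {e \<in> F. c (f ` e) = b} \<le> card {e \<in> edges G. c (f ` e) = b}"
      using F(1) finE by (intro card_mono) auto
    ultimately show ?thesis
      by simp
  qed
  have "card {e \<in> edges G. c (f ` e) = Red} + card {e \<in> edges G. c (f ` e) = Blue} \<le> 2 * m + 1"
    using card_color_compl[OF finE, of "\<lambda>e. c (f ` e)"] m by (simp add: num_edges_def)
  \<comment> \<open>Both counts are at least \<open>m\<close> and their sum is at most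
    \<open>2 * m + 1\<close>, so one of them is exactly \<open>m\<close>.\<close>
  then have "card {e \<in> edges G. c (f ` e) = Red} = m \<or> card {e \<in> edges G. c (f ` e) = Blue} = m"
    using ge[of Red] ge[of Blue] by linarith
  then obtain b where "card {e \<in> edges G. c (f ` e) = b} = m"
    by blast
  then show ?thesis
    unfolding has_balanced_copy_iff[OF G] m using f by (intro exI[of _ f] exI[of _ b]) simp
qed

section \<open>Necessity: star and matching colourings\<close>

text \<open>By injectivity the two edges have distinct, hence disjoint, images in \<open>M\<close>,
  and a common vertex would lie in both images.\<close>

lemma matching_coloring_disjoint:
  assumes "inj_on f V" "e \<in> [V]\<^bsup>2\<^esup>" "e' \<in> [V]\<^bsup>2\<^esup>" "e \<noteq> e'"
    and "pairwise disjnt M" "f ` e \<in> M" "f ` e' \<in> M"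
  shows "disjnt e e'"
proof -
  have "e \<subseteq> V" "e' \<subseteq> V"
    using assms by (auto simp: nsets_def)
  then have "f ` e \<noteq> f ` e'"
    using assms(1,4) by (simp add: inj_on_image_eq_iff)
  then have "disjnt (f ` e) (f ` e')"
    using assms(5-7) by (simp add: pairwise_def)
  then show ?thesis
    by (auto simp: disjnt_def)
qed

lemma constant_balancing_number_necessary:
  assumes G: "fin_graph G" and k: "2 \<le> num_edges G" and const: "constant_balancing_number G"
  obtains x M where "x \<in> verts G"
    "degree G x = num_edges G div 2 \<or> degree G x = num_edges G - num_edges G div 2"
    "matching G M" "card M = num_edges G div 2"
proof -
  define m where "m = num_edges G div 2"
  have m: "0 < m" "m \<le> num_edges G - m"
    using k by (auto simp: m_def)
  have finE: "finite (edges G)"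
    using G by (rule fin_graphD)
  obtain d N where "\<forall>n\<ge>N. bal n G \<le> enat d"
    using const by (auto simp: constant_balancing_number_def)
  \<comment> \<open>Large enough that \<open>n - 2\<close> exceeds \<open>d\<close> (stars with
    leaves from \<open>2\<close> on) and that \<open>2 * d + 1\<close> is still a vertex (the
    matching below).\<close>
  moreover define n where "n = N + 2 * d + 4"
  ultimately have bal: "has_balanced_copy n c G"
    if "\<And>a. d < card (color_class c (complete_graph n) a)" for c
    using that by (simp add: bal_le_iff)
  have finK: "finite (color_class c (complete_graph n) a)" for c a
    by (simp add: color_class_def complete_graph_def edges_def finite_imp_finite_nsets)
  \<comment> \<open>Used with centre \<open>0\<close> for red and \<open>1\<close> for blue in
    \<open>c1\<close>, and with centre \<open>0\<close> for blue in \<open>c2\<close>.\<close>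
  have star: "d < card (color_class c (complete_graph n) a)"
    if "\<And>i. i \<in> {2..<n} \<Longrightarrow> c {j, i} = a" "j < 2" for c j a
  proof -
    have "inj_on (\<lambda>i. {j, i}) {2..<n}"
      using that(2) by (auto simp: inj_on_def doubleton_eq_iff)
    then have "card ((\<lambda>i. {j, i}) ` {2..<n}) = n - 2"
      by (simp add: card_image)
    moreover have "(\<lambda>i. {j, i}) ` {2..<n} \<subseteq> color_class c (complete_graph n) a"
      using that by (auto simp: color_class_def complete_graph_def edges_def)
    ultimately have "n - 2 \<le> card (color_class c (complete_graph n) a)"
      using card_mono[OF finK] by metis
    then show ?thesis
      by (simp add: n_def)
  qed
  \<comment> \<open>Whichever colour is the balanced one, this pins down the number of red edges up
    to two values.\<close>
  have red_count: "card {e \<in> edges G. c (f ` e) = Red} = m \<or>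
      card {e \<in> edges G. c (f ` e) = Red} = num_edges G - m"
    if "card {e \<in> edges G. c (f ` e) = a} = m" for c a and f :: "'a \<Rightarrow> nat"
    using that card_color_compl[OF finE, of "\<lambda>e. c (f ` e)"]
    by (cases a) (auto simp: num_edges_def)

  \<comment> \<open>The red edges are those through \<open>0\<close>, so their number in a copy is
    the degree of the vertex placed at \<open>0\<close>. As both possible values are positive, there
    is such a vertex.\<close>
  define c1 where "c1 e = (if (0::nat) \<in> e then Red else Blue)" for e
  have "d < card (color_class c1 (complete_graph n) a)" for a
    by (cases a) (auto intro: star[of c1 0] star[of c1 1] simp: c1_def)
  then have "has_balanced_copy n c1 G"
    by (rule bal)
  then obtain f a where f: "inj_on f (verts G)" "card {e \<in> edges G. c1 (f ` e) = a} = m"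
    unfolding has_balanced_copy_iff[OF G] m_def by blast
  have "{e \<in> edges G. c1 (f ` e) = Red} = {e \<in> edges G. 0 \<in> f ` e}"
    by (auto simp: c1_def)
  then have deg: "card {e \<in> edges G. 0 \<in> f ` e} = m \<or> card {e \<in> edges G. 0 \<in> f ` e} = num_edges G - m"
    using red_count[OF f(2)] by simp
  then have "{e \<in> edges G. 0 \<in> f ` e} \<noteq> {}"
    using m by (metis card.empty less_le_not_le)
  then obtain e x where x: "e \<in> edges G" "x \<in> e" "f x = 0"
    by auto
  then have xV: "x \<in> verts G"
    using fin_graphD(4)[OF G] by auto
  have "0 \<in> f ` e \<longleftrightarrow> x \<in> e" if "e \<in> edges G" for e
    using inj_on_image_mem_iff[OF f(1) xV, of e] x(3) that fin_graphD(4)[OF G] by auto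
  then have "{e \<in> edges G. 0 \<in> f ` e} = {e \<in> edges G. x \<in> e}"
    by blast
  with deg have degx: "degree G x = m \<or> degree G x = num_edges G - m"
    by (simp add: degree_def)

  \<comment> \<open>These \<open>d + 1\<close> disjoint pairs are the red edges of
    \<open>c2\<close>, so the red edges of a copy pull back to a matching of
    \<open>G\<close>.\<close>
  define D where "D = (\<lambda>i. {2 * i, 2 * i + 1}) ` {..d}"
  have D: "pairwise disjnt D"
    unfolding D_def pairwise_def by (auto simp: disjnt_def) presburger+
  define c2 where "c2 e = (if e \<in> D then Red else Blue)" for e
  have "inj_on (\<lambda>i::nat. {2 * i, 2 * i + 1}) {..d}"
    by (rule inj_onI) (simp only: doubleton_eq_iff, arith)
  then have "card D = Suc d"
    by (simp add: D_def card_image)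
  moreover have "D \<subseteq> color_class c2 (complete_graph n) Red"
    by (auto simp: D_def color_class_def complete_graph_def edges_def n_def c2_def)
  ultimately have "d < card (color_class c2 (complete_graph n) Red)"
    using card_mono[OF finK] by (metis Suc_le_eq)
  moreover have "{0, i} \<notin> D" if "i \<in> {2..<n}" for i
    using that by (auto simp: D_def doubleton_eq_iff)
  then have "d < card (color_class c2 (complete_graph n) Blue)"
    by (intro star[of c2 0]) (auto simp: c2_def)
  ultimately have "d < card (color_class c2 (complete_graph n) a)" for a
    by (cases a) auto
  then have "has_balanced_copy n c2 G"
    by (rule bal)
  then obtain g b where g: "inj_on g (verts G)" "card {e \<in> edges G. c2 (g ` e) = b} = m"
    unfolding has_balanced_copy_iff[OF G] m_def by blast
  define M where "M = {e \<in> edges G. g ` e \<in> D}"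
  have "M = {e \<in> edges G. c2 (g ` e) = Red}"
    by (auto simp: M_def c2_def)
  then have "m \<le> card M"
    using red_count[OF g(2)] m by auto
  moreover have "pairwise disjnt M"
    using matching_coloring_disjoint[OF g(1) _ _ _ D] fin_graphD(3)[OF G]
    by (auto simp: M_def pairwise_def)
  then have "matching G M"
    by (auto simp: matching_def M_def)
  moreover from \<open>m \<le> card M\<close> obtain M' where "M' \<subseteq> M" "card M' = m"
    by (meson obtain_subset_with_card_n)
  ultimately have "matching G M'" "card M' = m"
    by (auto simp: matching_def intro: pairwise_subset)
  with xV degx show ?thesis
    using that by (simp add: m_def)
qed

section \<open>Embedding into the unavoidable patterns\<close>

definition mono_clique :: "(nat set \<Rightarrow> color) \<Rightarrow> color \<Rightarrow> nat set \<Rightarrow> bool" where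
  "mono_clique c a A \<longleftrightarrow> (\<forall>x\<in>A. \<forall>y\<in>A. x \<noteq> y \<longrightarrow> c {x, y} = a)"

definition pointed_clique :: "(nat set \<Rightarrow> color) \<Rightarrow> nat set \<Rightarrow> nat \<Rightarrow> bool" where
  "pointed_clique c W r \<longleftrightarrow>
     (\<exists>v A a. v \<in> W \<and> A \<subseteq> W \<and> v \<notin> A \<and> card A = r \<and> mono_clique c a A \<and> (\<forall>x\<in>A. c {v, x} \<noteq> a))"

text \<open>The matching edges are \<open>{u i, v i}\<close>. Numbering them and naming their ends
  lets Ramsey's theorem act on the indices and lets an embedding choose the side of each
  vertex.\<close>

definition planted_matching :: "(nat set \<Rightarrow> color) \<Rightarrow> nat set \<Rightarrow> nat \<Rightarrow> bool" where
  "planted_matching c W r \<longleftrightarrow>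
     (\<exists>(I::nat set) u v a. card I = r \<and> u ` I \<subseteq> W \<and> v ` I \<subseteq> W \<and> inj_on u I \<and> inj_on v I \<and>
        u ` I \<inter> v ` I = {} \<and>
        (\<forall>i\<in>I. \<forall>j\<in>I. c {u i, v j} = a \<longleftrightarrow> i = j) \<and>
        (\<forall>i\<in>I. \<forall>j\<in>I. i \<noteq> j \<longrightarrow> c {u i, u j} \<noteq> a \<and> c {v i, v j} \<noteq> a))"

text \<open>With \<open>x\<close> at the apex and all other vertices in the clique, an edge avoids
  the clique colour exactly if it contains \<open>x\<close>.\<close>

lemma embed_pointed_clique:
  assumes V: "finite V" "F \<subseteq> [V]\<^bsup>2\<^esup>" and x: "x \<in> V" and P: "pointed_clique c W (card V)"
  obtains f a where "inj_on f V" "f ` V \<subseteq> W" "{e \<in> F. c (f ` e) \<noteq> a} = {e \<in> F. x \<in> e}"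
proof -
  obtain v A a where A: "v \<in> W" "A \<subseteq> W" "v \<notin> A" "card A = card V" "mono_clique c a A"
      "\<And>y. y \<in> A \<Longrightarrow> c {v, y} \<noteq> a"
    using P by (auto simp: pointed_clique_def)
  have "finite A"
    using A(4) V(1) x by (metis card.infinite card_gt_0_iff empty_iff less_numeral_extra(3))
  then obtain g where g: "inj_on g V" "g ` V \<subseteq> A"
    using V(1) A(4) by (metis card_le_inj order_refl)
  \<comment> \<open>\<open>g\<close> puts all of \<open>V\<close> into the clique; moving
    \<open>x\<close> to the apex keeps injectivity because \<open>v\<close> is not in
    \<open>A\<close>.\<close>
  define f where "f = g(x := v)"
  have gA: "g y \<in> A" if "y \<in> V" for y
    using g(2) that by auto
  have inj: "inj_on f V"
    using g(1) gA A(3) by (auto simp: f_def inj_on_def)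
  have ran: "f ` V \<subseteq> W"
    using gA A(1,2) by (auto simp: f_def)
  have *: "c (f ` e) \<noteq> a \<longleftrightarrow> x \<in> e" if "e \<in> F" for e
  proof -
    from that V(2) have "e \<in> [V]\<^bsup>2\<^esup>"
      by blast
    then obtain y z where e: "e = {y, z}" "y \<in> V" "z \<in> V" "y \<noteq> z"
      by (rule nsets2_E)
    have "g y \<noteq> g z"
      using g(1) e by (auto simp: inj_on_def)
    then show ?thesis
      using e gA A(5) A(6)[OF gA[OF e(2)]] A(6)[OF gA[OF e(3)]]
      by (auto simp: f_def mono_clique_def insert_commute)
  qed
  have "{e \<in> F. c (f ` e) \<noteq> a} = {e \<in> F. x \<in> e}"
    using * by auto
  with inj ran show ?thesis
    by (rule that)
qed

lemma matching_edge_unique: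
  assumes "pairwise disjnt M" "e \<in> M" "e' \<in> M" "w \<in> e" "w \<in> e'"
  shows "e = e'"
  using pairwiseD[OF assms(1-3)] assms(4,5) by (auto simp: disjnt_def)

text \<open>\<open>q\<close> chooses an endpoint of every edge of \<open>M\<close> and fixes the vertices that \<open>M\<close> does not cover.\<close>
lemma matching_selector:
  assumes M: "pairwise disjnt M"
  obtains q :: "'a \<Rightarrow> 'a" where "\<And>w. q w = w \<or> {w, q w} \<in> M"
    "\<And>w w'. w \<noteq> w' \<Longrightarrow> q w = q w' \<longleftrightarrow> {w, w'} \<in> M"
proof -
  \<comment> \<open>\<open>C w\<close> consists of \<open>w\<close> and its partner in
    \<open>M\<close>, if any. The choice depends only on this set, so partners choose the same
    vertex.\<close>
  define C where "C w = {y. y = w \<or> {w, y} \<in> M}" for w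
  define q where "q w = (SOME y. y \<in> C w)" for w
  have uniq: "w = w'" if "{w, z} \<in> M" "{w', z} \<in> M" for w w' z
  proof -
    have "{w, z} = {w', z}"
      using matching_edge_unique[OF M that] by blast
    then show ?thesis
      by (auto simp: doubleton_eq_iff)
  qed
  have q: "q w \<in> C w" for w
    unfolding q_def by (rule someI[of _ w]) (simp add: C_def)
  have sub: "C w \<subseteq> C w'" if "{w, w'} \<in> M" for w w'
  proof
    fix y assume "y \<in> C w"
    then consider "y = w" | "{w, y} \<in> M"
      by (auto simp: C_def)
    then show "y \<in> C w'"
    proof cases
      case 1
      then show ?thesis
        using that by (simp add: C_def insert_commute)
    next
      case 2
      then have "{w, y} = {w, w'}"
        using matching_edge_unique[OF M 2 that, of w] by simp
      then have "y = w'"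
        by (auto simp: doubleton_eq_iff)
      then show ?thesis
        by (simp add: C_def)
    qed
  qed
  show ?thesis
  proof (rule that[of q])
    show "q w = w \<or> {w, q w} \<in> M" for w
      using q[of w] by (auto simp: C_def)
    show "q w = q w' \<longleftrightarrow> {w, w'} \<in> M" if "w \<noteq> w'" for w w'
    proof
      assume "q w = q w'"
      then have "q w \<in> C w" "q w \<in> C w'"
        using q[of w] q[of w'] by auto
      then show "{w, w'} \<in> M"
        using that uniq by (auto simp: C_def insert_commute)
    next
      assume "{w, w'} \<in> M"
      then have "C w = C w'"
        using sub by (metis insert_commute subset_antisym)
      then show "q w = q w'"
        by (simp add: q_def)
    qed
  qed
qed

text \<open>The index of a vertex \<open>w\<close> is taken from \<open>q w\<close>, so two distinct
  vertices share an index exactly if they form an edge of \<open>M\<close>. Fixed points of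
  \<open>q\<close> go to the \<open>u\<close> side, all others to the \<open>v\<close> side, and
  only pairs with a common index get colour \<open>a\<close>.\<close>

lemma embed_planted_matching:
  assumes V: "finite V" "F \<subseteq> [V]\<^bsup>2\<^esup>" and M: "M \<subseteq> F" "pairwise disjnt M"
    and P: "planted_matching c W (card V)"
  obtains f a where "inj_on f V" "f ` V \<subseteq> W" "{e \<in> F. c (f ` e) = a} = M"
proof -
  obtain I u v a where I: "card (I::nat set) = card V" "u ` I \<subseteq> W" "v ` I \<subseteq> W"
      "inj_on u I" "inj_on v I" "u ` I \<inter> v ` I = {}"
      "\<And>i j. i \<in> I \<Longrightarrow> j \<in> I \<Longrightarrow> c {u i, v j} = a \<longleftrightarrow> i = j"
      "\<And>i j. i \<in> I \<Longrightarrow> j \<in> I \<Longrightarrow> i \<noteq> j \<Longrightarrow> c {u i, u j} \<noteq> a"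
      "\<And>i j. i \<in> I \<Longrightarrow> j \<in> I \<Longrightarrow> i \<noteq> j \<Longrightarrow> c {v i, v j} \<noteq> a"
    using P unfolding planted_matching_def by (elim exE conjE) (rule that, auto)
  \<comment> \<open>Empty \<open>V\<close> is separate: cardinality \<open>0\<close> would also
    allow an infinite \<open>I\<close>.\<close>
  obtain g where g: "inj_on g V" "g ` V \<subseteq> I"
  proof (cases "V = {}")
    case False
    then have "finite I"
      using I(1) V(1) by (metis card.infinite card_0_eq)
    then show ?thesis
      using that V(1) I(1) by (metis card_le_inj order_refl)
  qed (use that in auto)
  obtain q where q: "\<And>w. q w = w \<or> {w, q w} \<in> M"
      "\<And>w w'. w \<noteq> w' \<Longrightarrow> q w = q w' \<longleftrightarrow> {w, w'} \<in> M"
    using matching_selector[OF M(2)] by metis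
  have MV: "x \<in> V" "y \<in> V" "x \<noteq> y" if "{x, y} \<in> M" for x y
    using subsetD[OF V(2) subsetD[OF M(1) that]] by (auto simp: nsets_def card_insert_if split: if_splits)
  have qV: "q w \<in> V" if "w \<in> V" for w
    using q(1)[of w] MV(2) that by metis
  have qI: "g (q w) \<in> I" if "w \<in> V" for w
    using qV[OF that] g(2) by auto
  have geq: "g x = g y \<longleftrightarrow> x = y" if "x \<in> V" "y \<in> V" for x y
    using g(1) that by (auto simp: inj_on_def)
  \<comment> \<open>At most one end of an edge of \<open>M\<close> is moved by \<open>q\<close>.
    This gives injectivity on the \<open>v\<close> side.\<close>
  have nofix: "w = w'" if "q w \<noteq> w" "q w' \<noteq> w'" "q w = q w'" for w w'
  proof (rule ccontr)
    assume "w \<noteq> w'"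
    have "{w, q w} \<in> M" "{w, w'} \<in> M"
      using that(1,3) q(1)[of w] q(2)[OF \<open>w \<noteq> w'\<close>] by simp_all
    then have "{w, q w} = {w, w'}"
      using matching_edge_unique[OF M(2)] by blast
    then show False
      using that by (auto simp: doubleton_eq_iff)
  qed
  define f where "f w = (if q w = w then u (g (q w)) else v (g (q w)))" for w
  have uv: "u i \<noteq> v j" "v j \<noteq> u i" if "i \<in> I" "j \<in> I" for i j
    using I(6) that by blast+
  have ui: "u i = u j \<longleftrightarrow> i = j" and vi: "v i = v j \<longleftrightarrow> i = j" if "i \<in> I" "j \<in> I" for i j
    using I(4,5) that by (auto simp: inj_on_def)
  have inj: "inj_on f V"
  proof (rule inj_onI)
    fix w w' assume w: "w \<in> V" "w' \<in> V" and "f w = f w'"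
    then have "q w = q w'" "q w = w \<longleftrightarrow> q w' = w'"
      using qI[OF w(1)] qI[OF w(2)] qV[OF w(1)] qV[OF w(2)]
      by (auto simp: f_def uv ui vi geq split: if_splits)
    then show "w = w'"
      using nofix by metis
  qed
  have "u (g (q w)) \<in> W" "v (g (q w)) \<in> W" if "w \<in> V" for w
    using qI[OF that] I(2,3) by blast+
  then have "f ` V \<subseteq> W"
    unfolding f_def by (simp only: image_subset_iff split: if_split) blast
  moreover have "c (f ` e) = a \<longleftrightarrow> e \<in> M" if "e \<in> F" for e
  proof -
    from that V(2) have "e \<in> [V]\<^bsup>2\<^esup>"
      by blast
    then obtain y z where e: "e = {y, z}" "y \<in> V" "z \<in> V" "y \<noteq> z"
      by (rule nsets2_E)
    have fe: "f ` e = {f y, f z}"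
      using e(1) by auto
    have M_iff: "e \<in> M \<longleftrightarrow> q y = q z"
      using q(2)[OF e(4)] e(1) by simp
    note * = qI[OF e(2)] qI[OF e(3)]
    have g_iff: "g (q y) = g (q z) \<longleftrightarrow> q y = q z"
      using geq qV e(2,3) by simp
    consider "q y = y" "q z = z" | "q y = y" "q z \<noteq> z" | "q y \<noteq> y" "q z = z" | "q y \<noteq> y" "q z \<noteq> z"
      by blast
    then show ?thesis
    proof cases
      case 1
      then have "q y \<noteq> q z" using e(4) by simp
      then show ?thesis
        using 1 I(8)[OF *] M_iff g_iff unfolding fe f_def by simp
    next
      case 2
      then show ?thesis
        using I(7)[OF *] M_iff g_iff unfolding fe f_def by simp
    next
      case 3
      then show ?thesis
        using I(7)[OF *(2,1)] M_iff g_iff unfolding fe f_def by (auto simp: insert_commute)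
    next
      case 4
      then have "q y \<noteq> q z" using e(4) nofix by blast
      then show ?thesis
        using 4 I(9)[OF *] M_iff g_iff unfolding fe f_def by simp
    qed
  qed
  then have "{e \<in> F. c (f ` e) = a} = M"
    using M(1) by auto
  ultimately show ?thesis
    using that inj by blast
qed

section \<open>Finding the patterns\<close>

lemma other_color:
  obtains b :: color where "b \<noteq> a" "\<And>x. x \<noteq> a \<longleftrightarrow> x = b"
  by (cases a) (metis color.distinct(1) color.exhaust)+

lemma mono_clique_subset: "mono_clique c a A \<Longrightarrow> B \<subseteq> A \<Longrightarrow> mono_clique c a B"
  by (auto simp: mono_clique_def)

text \<open>Ramsey's theorem is applied to increasing index pairs only; since edges are unordered,
  this settles both orders.\<close>

lemma mono_clique_imageI:
  fixes R :: "nat set"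
  assumes "\<forall>i\<in>R. \<forall>j\<in>R. i < j \<longrightarrow> c {w i, w j} = a"
  shows "mono_clique c a (w ` R)"
  unfolding mono_clique_def
proof (intro ballI impI)
  fix x y assume "x \<in> w ` R" "y \<in> w ` R" "x \<noteq> y"
  then obtain i j where ij: "i \<in> R" "j \<in> R" "x = w i" "y = w j" "i \<noteq> j"
    by blast
  show "c {x, y} = a"
  proof (cases "i < j")
    case True
    then show ?thesis
      using assms ij by blast
  next
    case False
    then have "c {w j, w i} = a"
      using assms ij by auto
    then show ?thesis
      using ij by (simp add: insert_commute)
  qed
qed

lemma pointed_cliqueI:
  assumes "v \<in> W" "A \<subseteq> W" "v \<notin> A" "r \<le> card A" "mono_clique c a A" "\<And>x. x \<in> A \<Longrightarrow> c {v, x} \<noteq> a"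
  shows "pointed_clique c W r"
proof -
  obtain B where "B \<subseteq> A" "card B = r"
    using obtain_subset_with_card_n assms(4) by metis
  with assms show ?thesis
    unfolding pointed_clique_def
    by (intro exI[of _ v] exI[of _ B] exI[of _ a]) (auto intro: mono_clique_subset)
qed

lemma pointed_clique_mono: "pointed_clique c W s \<Longrightarrow> r \<le> s \<Longrightarrow> pointed_clique c W r"
  by (auto simp: pointed_clique_def[of c W s] intro: pointed_cliqueI)

lemma planted_matchingI:
  fixes I :: "nat set"
  assumes "r \<le> card I" "u ` I \<subseteq> W" "v ` I \<subseteq> W" "inj_on u I" "inj_on v I" "u ` I \<inter> v ` I = {}"
    and "\<And>i j. i \<in> I \<Longrightarrow> j \<in> I \<Longrightarrow> c {u i, v j} = a \<longleftrightarrow> i = j"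
    and "\<And>i j. i \<in> I \<Longrightarrow> j \<in> I \<Longrightarrow> i \<noteq> j \<Longrightarrow> c {u i, u j} \<noteq> a"
    and "\<And>i j. i \<in> I \<Longrightarrow> j \<in> I \<Longrightarrow> i \<noteq> j \<Longrightarrow> c {v i, v j} \<noteq> a"
  shows "planted_matching c W r"
proof -
  obtain J where J: "J \<subseteq> I" "card J = r"
    using obtain_subset_with_card_n assms(1) by metis
  have "u ` J \<subseteq> W" "v ` J \<subseteq> W" "inj_on u J" "inj_on v J" "u ` J \<inter> v ` J = {}"
    using assms(2-6) J(1) by (blast intro: inj_on_subset)+
  moreover have "\<forall>i\<in>J. \<forall>j\<in>J. c {u i, v j} = a \<longleftrightarrow> i = j"
      "\<forall>i\<in>J. \<forall>j\<in>J. i \<noteq> j \<longrightarrow> c {u i, u j} \<noteq> a \<and> c {v i, v j} \<noteq> a"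
    using assms(7-9) subsetD[OF J(1)] by simp_all
  ultimately show ?thesis
    unfolding planted_matching_def using J(2) by blast
qed

lemma planted_matching_mono:
  assumes "planted_matching c W s" "r \<le> s"
  shows "planted_matching c W r"
  using assms(1) unfolding planted_matching_def[of c W s]
  by (elim exE conjE) (rule planted_matchingI, use assms(2) in auto)

section \<open>Ramsey's theorem for relations on increasing pairs\<close>

text \<open>Reading \<open>P\<close> only for \<open>i < j\<close> admits asymmetric relations, such
  as the colour of \<open>{u i, v j}\<close>. The clause \<open>s \<le> N\<close> makes sizes
  comparable along nested applications.\<close>

definition ordered_arrow :: "nat \<Rightarrow> nat \<Rightarrow> bool" where
  "ordered_arrow s N \<longleftrightarrow> s \<le> N \<and> (\<forall>(V::nat set) P. finite V \<and> N \<le> card V \<longrightarrow>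
     (\<exists>R\<subseteq>V. card R = s \<and>
        ((\<forall>i\<in>R. \<forall>j\<in>R. i < j \<longrightarrow> P i j) \<or> (\<forall>i\<in>R. \<forall>j\<in>R. i < j \<longrightarrow> \<not> P i j))))"

lemma ordered_arrow_exists: "\<exists>N. ordered_arrow s N"
proof -
  obtain N where N: "\<And>(V::nat set) E. finite V \<Longrightarrow> N \<le> card V \<Longrightarrow>
      \<exists>R\<subseteq>V. card R = s \<and> clique R E \<or> card R = s \<and> indep R E"
    using ramsey2[of s s, where 'a = nat] by blast
  have "\<exists>R\<subseteq>V. card R = s \<and>
      ((\<forall>i\<in>R. \<forall>j\<in>R. i < j \<longrightarrow> P i j) \<or> (\<forall>i\<in>R. \<forall>j\<in>R. i < j \<longrightarrow> \<not> P i j))"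
    if V: "finite V" "max s N \<le> card V" for V :: "nat set" and P
  proof -
    obtain R where R: "R \<subseteq> V" "card R = s"
        "clique R {{i, j} | i j. i < j \<and> P i j} \<or> indep R {{i, j} | i j. i < j \<and> P i j}"
      using N[of V "{{i, j} | i j. i < j \<and> P i j}"] V by auto
    \<comment> \<open>An unordered pair determines its increasing order, so the graph encodes
      \<open>P\<close> faithfully.\<close>
    have "{i, j} \<in> {{i, j} | i j. i < j \<and> P i j} \<longleftrightarrow> P i j" if "i < j" for i j
      using that by (auto simp: doubleton_eq_iff)
    with R(3) have "(\<forall>i\<in>R. \<forall>j\<in>R. i < j \<longrightarrow> P i j) \<or> (\<forall>i\<in>R. \<forall>j\<in>R. i < j \<longrightarrow> \<not> P i j)"
      unfolding clique_def indep_def by (elim disjE) (metis (no_types, lifting) less_imp_neq)+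
    then show ?thesis
      using R(1,2) by blast
  qed
  then show ?thesis
    unfolding ordered_arrow_def by (intro exI[of _ "max s N"]) auto
qed

lemma ordered_arrowE:
  fixes V :: "nat set"
  assumes "ordered_arrow s N" "finite V" "N \<le> card V"
  obtains R where "R \<subseteq> V" "card R = s"
    "(\<forall>i\<in>R. \<forall>j\<in>R. i < j \<longrightarrow> P i j) \<or> (\<forall>i\<in>R. \<forall>j\<in>R. i < j \<longrightarrow> \<not> P i j)"
proof -
  note * = assms(1)[unfolded ordered_arrow_def, THEN conjunct2]
  from mp[OF spec[OF spec[OF *, of V], of P] conjI[OF assms(2,3)]] show ?thesis
    by (elim exE conjE) (rule that)
qed

section \<open>Many edges of one colour\<close>

text \<open>A maximal matching with fewer than \<open>t\<close> edges covers at most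
  \<open>2 * t\<close> vertices, and every edge meets one of these, as otherwise the matching could
  be enlarged. If each of them had at most \<open>D\<close> edges, there would be at most
  \<open>2 * t * D\<close> edges.\<close>

lemma star_or_matching:
  assumes E: "finite E" "\<And>e. e \<in> E \<Longrightarrow> card e = 2" and large: "2 * t * D < card E"
  obtains v where "D < card {e \<in> E. v \<in> e}"
  | M where "M \<subseteq> E" "pairwise disjnt M" "card M = t"
proof -
  have "finite {M. M \<subseteq> E \<and> pairwise disjnt M}"
    using E(1) by simp
  moreover have "{} \<in> {M. M \<subseteq> E \<and> pairwise disjnt M}"
    by simp
  ultimately obtain M where M: "M \<subseteq> E" "pairwise disjnt M"
      and max: "\<And>M'. M' \<subseteq> E \<Longrightarrow> pairwise disjnt M' \<Longrightarrow> M \<subseteq> M' \<Longrightarrow> M = M'"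
    using finite_has_maximal[of "{M. M \<subseteq> E \<and> pairwise disjnt M}"]
    by (metis (mono_tags, lifting) emptyE mem_Collect_eq)
  show ?thesis
  proof (cases "t \<le> card M")
    case True
    then obtain M' where "M' \<subseteq> M" "card M' = t"
      by (meson obtain_subset_with_card_n)
    then show ?thesis
      using M pairwise_subset[OF M(2)] by (intro that(2)[of M']) auto
  next
    case False
    have finM: "finite M"
      using M(1) E(1) by (rule finite_subset)
    have "card (\<Union>M) \<le> (\<Sum>e\<in>M. card e)"
      by (rule card_Union_le_sum_card)
    also have "\<dots> = 2 * card M"
      using M(1) E(2) by (simp add: subset_iff)
    finally have UM: "card (\<Union>M) \<le> 2 * t"
      using False by simp
    have "finite e" if "e \<in> M" for e
      using that M(1) E(2) card.infinite by fastforce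
    then have finUM: "finite (\<Union>M)"
      using finM by blast
    have "\<exists>v\<in>\<Union>M. v \<in> e" if "e \<in> E" for e
    proof (rule ccontr)
      assume no: "\<not> (\<exists>v\<in>\<Union>M. v \<in> e)"
      then have "pairwise disjnt (insert e M)"
        using M(2) by (auto simp: pairwise_insert disjnt_def)
      then have "e \<in> M"
        using max[of "insert e M"] M(1) that by auto
      moreover have "e \<noteq> {}"
        using E(2)[OF that] by auto
      ultimately show False
        using no by auto
    qed
    then have "E \<subseteq> (\<Union>v\<in>\<Union>M. {e \<in> E. v \<in> e})"
      by blast
    then have "card E \<le> card (\<Union>v\<in>\<Union>M. {e \<in> E. v \<in> e})"
      by (rule card_mono[rotated]) (rule finite_UN_I[OF finUM], use E(1) in simp)
    also have "\<dots> \<le> (\<Sum>v\<in>\<Union>M. card {e \<in> E. v \<in> e})"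
      by (rule card_UN_le[OF finUM])
    finally have sum: "card E \<le> (\<Sum>v\<in>\<Union>M. card {e \<in> E. v \<in> e})" .
    have "\<exists>v. D < card {e \<in> E. v \<in> e}"
    proof (rule ccontr)
      assume "\<nexists>v. D < card {e \<in> E. v \<in> e}"
      then have "(\<Sum>v\<in>\<Union>M. card {e \<in> E. v \<in> e}) \<le> card (\<Union>M) * D"
        using sum_bounded_above[of "\<Union>M" "\<lambda>v. card {e \<in> E. v \<in> e}" D] by (auto simp: not_less)
      also have "\<dots> \<le> 2 * t * D"
        using UM by (rule mult_le_mono1)
      finally show False
        using sum large by linarith
    qed
    then show ?thesis
      using that(1) by blast
  qed
qed

text \<open>Ramsey's theorem among the leaves gives a clique of colour \<open>a\<close>, or one of
  the other colour, for which the centre \<open>v\<close> is an apex.\<close>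

lemma star_pattern:
  obtains N where "\<And>c W a v A. \<lbrakk>v \<in> W; A \<subseteq> W; v \<notin> A; finite A; N \<le> card A; \<And>x. x \<in> A \<Longrightarrow> c {v, x} = a\<rbrakk> \<Longrightarrow>
    pointed_clique c W r \<or> (\<exists>B\<subseteq>W. card B = r \<and> mono_clique c a B)"
proof -
  obtain N where N: "ordered_arrow r N"
    using ordered_arrow_exists by blast
  show ?thesis
  proof (rule that[of N])
    fix c :: "nat set \<Rightarrow> color" and W a v A
    assume A: "v \<in> W" "A \<subseteq> W" "v \<notin> A" "finite A" "N \<le> card A" "\<And>x. x \<in> A \<Longrightarrow> c {v, x} = a"
    obtain b where b: "b \<noteq> a" "\<And>x. x \<noteq> a \<longleftrightarrow> x = b"
      using other_color by blast
    obtain R where R: "R \<subseteq> A" "card R = r"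
        "(\<forall>i\<in>R. \<forall>j\<in>R. i < j \<longrightarrow> c {i, j} = a) \<or> (\<forall>i\<in>R. \<forall>j\<in>R. i < j \<longrightarrow> c {i, j} \<noteq> a)"
      by (rule ordered_arrowE[OF N A(4,5), of "\<lambda>i j. c {i, j} = a"])
    from R(3) consider "mono_clique c a R" | "mono_clique c b R"
      using mono_clique_imageI[of R c "\<lambda>i. i"] unfolding b(2) by auto
    then show "pointed_clique c W r \<or> (\<exists>B\<subseteq>W. card B = r \<and> mono_clique c a B)"
    proof cases
      case 1
      then show ?thesis
        using R(1,2) A(2) by blast
    next
      case 2
      then have "pointed_clique c W r"
        using R(1,2) A b(1) by (intro pointed_cliqueI[of v W R]) (auto simp: subset_iff)
      then show ?thesis ..
    qed
  qed
qed

text \<open>Four nested applications of Ramsey's theorem make the colours of \<open>u\<^sub>i u\<^sub>j\<close>, \<open>v\<^sub>i v\<^sub>j\<close>,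
  \<open>u\<^sub>i v\<^sub>j\<close> and \<open>v\<^sub>i u\<^sub>j\<close> constant over all \<open>i < j\<close>, where the \<open>u\<^sub>i v\<^sub>i\<close> are the matching edges.\<close>
lemma matching_pattern:
  obtains N where "\<And>c W a M. \<lbrakk>M \<subseteq> [W]\<^bsup>2\<^esup>; pairwise disjnt M; finite M; card M = N; \<And>e. e \<in> M \<Longrightarrow> c e = a\<rbrakk> \<Longrightarrow>
    pointed_clique c W r \<or> planted_matching c W r \<or> (\<exists>B\<subseteq>W. card B = r \<and> mono_clique c a B)"
proof -
  \<comment> \<open>Sizes are chosen backwards from the last application. It must leave
    \<open>Suc r\<close> indices because one of them may be spent on an apex.\<close>
  obtain N4 where N4: "ordered_arrow (Suc r) N4" using ordered_arrow_exists by blast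
  obtain N3 where N3: "ordered_arrow N4 N3" using ordered_arrow_exists by blast
  obtain N2 where N2: "ordered_arrow N3 N2" using ordered_arrow_exists by blast
  obtain N1 where N1: "ordered_arrow N2 N1" using ordered_arrow_exists by blast
  have le: "Suc r \<le> N4" "N4 \<le> N3" "N3 \<le> N2"
    using N4 N3 N2 by (simp_all add: ordered_arrow_def)
  show ?thesis
  proof (rule that[of N1])
    fix c :: "nat set \<Rightarrow> color" and W a M
    assume M: "M \<subseteq> [W]\<^bsup>2\<^esup>" "pairwise disjnt M" "finite M" "card M = N1" "\<And>e. e \<in> M \<Longrightarrow> c e = a"
    obtain b where b: "b \<noteq> a" "\<And>x. x \<noteq> a \<longleftrightarrow> x = b"
      using other_color by blast
    obtain h where h: "bij_betw h {0..<N1} M"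
      using ex_bij_betw_nat_finite[OF M(3)] M(4) by blast
    define I where "I = {0..<N1}"
    have "\<forall>i\<in>I. \<exists>x y. h i = {x, y} \<and> x \<noteq> y \<and> x \<in> W \<and> y \<in> W"
      using h M(1) unfolding I_def bij_betw_def by (metis image_eqI nsets2_E subsetD)
    then obtain u v where uv: "\<And>i. i \<in> I \<Longrightarrow> h i = {u i, v i}" "\<And>i. i \<in> I \<Longrightarrow> u i \<noteq> v i"
        "\<And>i. i \<in> I \<Longrightarrow> u i \<in> W" "\<And>i. i \<in> I \<Longrightarrow> v i \<in> W"
      by metis
    have dis: "{u i, v i} \<inter> {u j, v j} = {}" if "i \<in> I" "j \<in> I" "i \<noteq> j" for i j
    proof -
      have "h i \<noteq> h j" "h i \<in> M" "h j \<in> M"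
        using h that unfolding I_def bij_betw_def inj_on_def by auto
      then have "disjnt (h i) (h j)"
        using M(2) by (auto simp: pairwise_def)
      then show ?thesis
        using uv(1) that(1,2) by (simp add: disjnt_def)
    qed
    have inj: "inj_on u I" "inj_on v I" "u ` I \<inter> v ` I = {}"
      using dis uv(2) by (force simp: inj_on_def)+
    have edge: "c {u i, v i} = a" if "i \<in> I" for i
      using M(5) uv(1)[OF that] h that unfolding I_def bij_betw_def by (metis image_eqI)
    have finI: "finite I" "card I = N1"
      by (simp_all add: I_def)

    \<comment> \<open>Excludes colour \<open>a\<close> inside the \<open>u\<close> side and inside
      the \<open>v\<close> side, unless the third alternative holds.\<close>
    have clique: "\<exists>B\<subseteq>W. card B = r \<and> mono_clique c a B"
      if "R \<subseteq> I" "inj_on w I" "w ` I \<subseteq> W" "r \<le> card R"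
        "\<forall>i\<in>R. \<forall>j\<in>R. i < j \<longrightarrow> c {w i, w j} = a" for R and w :: "nat \<Rightarrow> nat"
    proof -
      have "mono_clique c a (w ` R)"
        using that(5) by (rule mono_clique_imageI)
      moreover have "card (w ` R) = card R"
        using that(1,2) by (meson card_image inj_on_subset)
      moreover have "w ` R \<subseteq> W"
        using that(1,3) by blast
      ultimately show ?thesis
        using that(4) by (metis mono_clique_subset obtain_subset_with_card_n subset_trans)
    qed
    \<comment> \<open>Excludes colour \<open>a\<close> on cross edges with \<open>i < j\<close>: the
      least index supplies the apex \<open>w i0\<close>, and every other index is larger, so the
      hypothesis on increasing pairs covers all its edges to the \<open>w'\<close> side.\<close>
    have pointed: "pointed_clique c W r"
      if R: "R \<subseteq> I" "Suc r \<le> card R" and w: "inj_on w' I" "w ` I \<subseteq> W" "w' ` I \<subseteq> W" "w ` I \<inter> w' ` I = {}"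
        and red: "\<forall>i\<in>R. \<forall>j\<in>R. i < j \<longrightarrow> c {w i, w' j} = a"
        and blue: "\<forall>i\<in>R. \<forall>j\<in>R. i < j \<longrightarrow> c {w' i, w' j} \<noteq> a" for R and w w' :: "nat \<Rightarrow> nat"
    proof -
      have finR: "finite R" and "R \<noteq> {}"
        using R finI(1) by (auto intro: finite_subset)
      define i0 where "i0 = Min R"
      have i0: "i0 \<in> R" "\<And>j. j \<in> R - {i0} \<Longrightarrow> i0 < j"
        using finR \<open>R \<noteq> {}\<close> unfolding i0_def by (auto simp: less_le)
      show ?thesis
      proof (rule pointed_cliqueI[of "w i0" W "w' ` (R - {i0})" r c b])
        have "inj_on w' (R - {i0})"
          using w(1) R(1) by (meson Diff_subset inj_on_subset subset_trans)
        then show "r \<le> card (w' ` (R - {i0}))"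
          using R(2) i0(1) finR by (simp add: card_image)
        show "mono_clique c b (w' ` (R - {i0}))"
          using blue unfolding b(2) by (intro mono_clique_imageI) blast
        show "c {w i0, x} \<noteq> b" if "x \<in> w' ` (R - {i0})" for x
          using that red i0 b(1) by auto
        show "w i0 \<notin> w' ` (R - {i0})"
          using w(4) i0(1) R(1) by blast
        show "w i0 \<in> W" "w' ` (R - {i0}) \<subseteq> W"
          using w(2,3) R(1) i0(1) by blast+
      qed
    qed

    obtain R1 where R1: "R1 \<subseteq> I" "card R1 = N2"
      "(\<forall>i\<in>R1. \<forall>j\<in>R1. i < j \<longrightarrow> c {u i, u j} = a) \<or> (\<forall>i\<in>R1. \<forall>j\<in>R1. i < j \<longrightarrow> c {u i, u j} \<noteq> a)"
      by (rule ordered_arrowE[OF N1 finI(1) eq_refl[OF finI(2)[symmetric]], of "\<lambda>i j. c {u i, u j} = a"])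
    have fin1: "finite R1"
      using R1(1) finI(1) by (rule finite_subset)
    obtain R2 where R2: "R2 \<subseteq> R1" "card R2 = N3"
      "(\<forall>i\<in>R2. \<forall>j\<in>R2. i < j \<longrightarrow> c {v i, v j} = a) \<or> (\<forall>i\<in>R2. \<forall>j\<in>R2. i < j \<longrightarrow> c {v i, v j} \<noteq> a)"
      by (rule ordered_arrowE[OF N2 fin1 eq_refl[OF R1(2)[symmetric]], of "\<lambda>i j. c {v i, v j} = a"])
    have fin2: "finite R2"
      using R2(1) fin1 by (rule finite_subset)
    obtain R3 where R3: "R3 \<subseteq> R2" "card R3 = N4"
      "(\<forall>i\<in>R3. \<forall>j\<in>R3. i < j \<longrightarrow> c {u i, v j} = a) \<or> (\<forall>i\<in>R3. \<forall>j\<in>R3. i < j \<longrightarrow> c {u i, v j} \<noteq> a)"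
      by (rule ordered_arrowE[OF N3 fin2 eq_refl[OF R2(2)[symmetric]], of "\<lambda>i j. c {u i, v j} = a"])
    have fin3: "finite R3"
      using R3(1) fin2 by (rule finite_subset)
    obtain R4 where R4: "R4 \<subseteq> R3" "card R4 = Suc r"
      "(\<forall>i\<in>R4. \<forall>j\<in>R4. i < j \<longrightarrow> c {v i, u j} = a) \<or> (\<forall>i\<in>R4. \<forall>j\<in>R4. i < j \<longrightarrow> c {v i, u j} \<noteq> a)"
      by (rule ordered_arrowE[OF N4 fin3 eq_refl[OF R3(2)[symmetric]], of "\<lambda>i j. c {v i, u j} = a"])
    have R4I: "R4 \<subseteq> I"
      using R1(1) R2(1) R3(1) R4(1) by blast
    have ranges: "u ` I \<subseteq> W" "v ` I \<subseteq> W"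
      using uv(3,4) by auto

    show "pointed_clique c W r \<or> planted_matching c W r \<or> (\<exists>B\<subseteq>W. card B = r \<and> mono_clique c a B)"
    proof (rule ccontr)
      assume contra: "\<not> ?thesis"
      have uu: "\<forall>i\<in>R1. \<forall>j\<in>R1. i < j \<longrightarrow> c {u i, u j} \<noteq> a"
        using R1 clique[OF R1(1) inj(1) ranges(1)] contra le by auto
      have "R2 \<subseteq> I"
        using R1(1) R2(1) by blast
      have "r \<le> card R2"
        using R2(2) le by simp
      then have vv: "\<forall>i\<in>R2. \<forall>j\<in>R2. i < j \<longrightarrow> c {v i, v j} \<noteq> a"
        using R2(3) clique[OF \<open>R2 \<subseteq> I\<close> inj(2) ranges(2)] contra by blast
      have "R3 \<subseteq> I" and vv3: "\<forall>i\<in>R3. \<forall>j\<in>R3. i < j \<longrightarrow> c {v i, v j} \<noteq> a"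
        using \<open>R2 \<subseteq> I\<close> R3(1) vv by blast+
      have "Suc r \<le> card R3"
        using R3(2) le by simp
      then have uv': "\<forall>i\<in>R3. \<forall>j\<in>R3. i < j \<longrightarrow> c {u i, v j} \<noteq> a"
        using R3(3) pointed[OF \<open>R3 \<subseteq> I\<close> _ inj(2) ranges inj(3) _ vv3] contra by blast
      have "R4 \<subseteq> R1"
        using R2(1) R3(1) R4(1) by blast
      then have uu4: "\<forall>i\<in>R4. \<forall>j\<in>R4. i < j \<longrightarrow> c {u i, u j} \<noteq> a"
        using uu by blast
      have vu: "\<forall>i\<in>R4. \<forall>j\<in>R4. i < j \<longrightarrow> c {v i, u j} \<noteq> a"
        using R4(3) pointed[OF R4I eq_refl[OF R4(2)[symmetric]] inj(1) ranges(2,1) _ _ uu4] inj(3) contra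
        by (metis Int_commute)
      \<comment> \<open>Off the diagonal every colour differs from \<open>a\<close>:
        \<open>uv'\<close> covers \<open>{u i, v j}\<close> for \<open>i < j\<close>, and
        \<open>vu\<close>, with the roles swapped, for \<open>j < i\<close>.\<close>
      have "planted_matching c W r"
      proof (rule planted_matchingI[of r R4 u W v c a])
        show "c {u i, u j} \<noteq> a" if "i \<in> R4" "j \<in> R4" "i \<noteq> j" for i j
          using uu4 that by (metis insert_commute nat_neq_iff)
        show "c {v i, v j} \<noteq> a" if "i \<in> R4" "j \<in> R4" "i \<noteq> j" for i j
          using vv subsetD[OF R3(1)] subsetD[OF R4(1)] that by (metis insert_commute nat_neq_iff)
        show "c {u i, v j} = a \<longleftrightarrow> i = j" if "i \<in> R4" "j \<in> R4" for i j
          using edge vu uv' subsetD[OF R4(1)] subsetD[OF R4I] that by (metis insert_commute nat_neq_iff)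
        show "inj_on u R4" "inj_on v R4"
          using inj R4I by (auto intro: inj_on_subset)
        show "u ` R4 \<subseteq> W" "v ` R4 \<subseteq> W" "u ` R4 \<inter> v ` R4 = {}"
          using R4I ranges inj(3) by blast+
      qed (use R4(2) in simp)
      with contra show False
        by blast
    qed
  qed
qed

text \<open>The threshold \<open>2 * t * D\<close> comes from \<open>star_or_matching\<close>, with
  \<open>D\<close> and \<open>t\<close> large enough for the star and the matching case.\<close>

lemma many_edges_pattern:
  obtains C where "\<And>c W a. \<lbrakk>finite W; C < card {e \<in> [W]\<^bsup>2\<^esup>. c e = a}\<rbrakk> \<Longrightarrow>
    pointed_clique c W r \<or> planted_matching c W r \<or> (\<exists>B\<subseteq>W. card B = r \<and> mono_clique c a B)"
proof -
  obtain D where D: "\<And>c W a v A. \<lbrakk>v \<in> W; A \<subseteq> W; v \<notin> A; finite A; D \<le> card A; \<And>x. x \<in> A \<Longrightarrow> c {v, x} = a\<rbrakk> \<Longrightarrow>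
      pointed_clique c W r \<or> (\<exists>B\<subseteq>W. card B = r \<and> mono_clique c a B)"
    using star_pattern[of r] by blast
  obtain t where t: "\<And>c W a M. \<lbrakk>M \<subseteq> [W]\<^bsup>2\<^esup>; pairwise disjnt M; finite M; card M = t; \<And>e. e \<in> M \<Longrightarrow> c e = a\<rbrakk> \<Longrightarrow>
      pointed_clique c W r \<or> planted_matching c W r \<or> (\<exists>B\<subseteq>W. card B = r \<and> mono_clique c a B)"
    using matching_pattern[of r] by blast
  show ?thesis
  proof (rule that[of "2 * t * D"])
    fix c :: "nat set \<Rightarrow> color" and W a
    assume W: "finite W" and large: "2 * t * D < card {e \<in> [W]\<^bsup>2\<^esup>. c e = a}"
    define E where "E = {e \<in> [W]\<^bsup>2\<^esup>. c e = a}"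
    have E: "finite E" "\<And>e. e \<in> E \<Longrightarrow> card e = 2"
      using W by (auto simp: E_def finite_imp_finite_nsets nsets_def)
    show "pointed_clique c W r \<or> planted_matching c W r \<or> (\<exists>B\<subseteq>W. card B = r \<and> mono_clique c a B)"
    proof (rule star_or_matching[OF E large[folded E_def]])
      fix M assume "M \<subseteq> E" "pairwise disjnt M" "card M = t"
      then show ?thesis
        using E(1) by (intro t[of M]) (auto simp: E_def intro: finite_subset)
    next
      fix v assume v: "D < card {e \<in> E. v \<in> e}"
      define A where "A = {x \<in> W. x \<noteq> v \<and> c {v, x} = a}"
      \<comment> \<open>Bounds the number of edges at \<open>v\<close> by the number of its
        neighbours.\<close>
      have "e \<in> (\<lambda>x. {v, x}) ` A" if "e \<in> E" "v \<in> e" for e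
      proof -
        have e: "e \<in> [W]\<^bsup>2\<^esup>" "c e = a"
          using that(1) by (simp_all add: E_def)
        from e(1) obtain x y where xy: "e = {x, y}" "x \<in> W" "y \<in> W" "x \<noteq> y"
          by (rule nsets2_E)
        have "v = x \<or> v = y"
          using that(2) xy(1) by blast
        then show ?thesis
          using xy e(2) by (auto simp: A_def insert_commute)
      qed
      then have "{e \<in> E. v \<in> e} \<subseteq> (\<lambda>x. {v, x}) ` A"
        by blast
      moreover have finA: "finite A"
        using W by (simp add: A_def)
      ultimately have "card {e \<in> E. v \<in> e} \<le> card A"
        by (rule surj_card_le[rotated])
      moreover have "v \<in> W"
      proof -
        have "{e \<in> E. v \<in> e} \<noteq> {}"
          using v by (metis card.empty not_less_zero)
        then show ?thesis
          by (auto simp: E_def nsets_def)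
      qed
      moreover have "A \<subseteq> W" "v \<notin> A" "\<And>x. x \<in> A \<Longrightarrow> c {v, x} = a"
        by (auto simp: A_def)
      ultimately have "pointed_clique c W r \<or> (\<exists>B\<subseteq>W. card B = r \<and> mono_clique c a B)"
        using v by (intro D[of v W A c a] finA) simp_all
      then show ?thesis
        by blast
    qed
  qed
qed

section \<open>Combining the two colours\<close>

text \<open>Cliques of opposite colours share at most one vertex; without it there remain disjoint
  \<open>P\<close> and \<open>Q\<close> of size \<open>2 * r\<close>. If no vertex is an apex, each
  vertex of \<open>P\<close> has at most \<open>r - 1\<close> red edges to \<open>Q\<close>, and
  each vertex of \<open>Q\<close> at most \<open>r - 1\<close> blue edges to \<open>P\<close>. This
  accounts for at most \<open>4 * r * (r - 1)\<close> of the \<open>4 * r * r\<close> pairs.\<close>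

lemma opposite_cliques_pointed:
  assumes r: "0 < r" and A: "A \<subseteq> W" "card A = 2 * r + 1" "mono_clique c Red A"
    and B: "B \<subseteq> W" "card B = 2 * r + 1" "mono_clique c Blue B"
  shows "pointed_clique c W r"
proof (rule ccontr)
  assume contra: "\<not> pointed_clique c W r"
  \<comment> \<open>Writing \<open>k\<close> for \<open>r - 1\<close> avoids truncated subtraction
    in the final count.\<close>
  obtain k where k: "r = Suc k"
    using r by (cases r) auto
  have fin: "finite A" "finite B"
    using A(2) B(2) by (simp_all add: card_ge_0_finite)
  have "\<exists>x. A \<inter> B \<subseteq> {x}"
  proof (rule ccontr)
    assume "\<nexists>x. A \<inter> B \<subseteq> {x}"
    then obtain x y where "x \<in> A \<inter> B" "y \<in> A \<inter> B" "x \<noteq> y"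
      by blast
    then have "c {x, y} = Red" "c {x, y} = Blue"
      using A(3) B(3) unfolding mono_clique_def by blast+
    then show False
      by simp
  qed
  then obtain x where x: "A \<inter> B \<subseteq> {x}" by blast
  define A' B' where "A' = A - {x}" and "B' = B - {x}"
  have sub: "A' \<subseteq> W" "B' \<subseteq> W" "A' \<inter> B' = {}" and finA': "finite A'" and finB': "finite B'"
    using A(1) B(1) x fin by (auto simp: A'_def B'_def)
  have mono: "mono_clique c Red A'" "mono_clique c Blue B'"
    using A(3) B(3) by (auto simp: A'_def B'_def intro: mono_clique_subset)
  have "2 * r \<le> card A'" "2 * r \<le> card B'"
    using A(2) B(2) by (simp_all add: A'_def B'_def card_Diff_singleton_if)
  then obtain P Q where P: "P \<subseteq> A'" "card P = 2 * r" and Q: "Q \<subseteq> B'" "card Q = 2 * r"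
    by (meson obtain_subset_with_card_n)
  have finPQ: "finite P" "finite Q"
    using P(1) Q(1) finA' finB' by (auto intro: finite_subset)
  have red: "card {q \<in> Q. c {p, q} = Red} \<le> k" if "p \<in> P" for p
  proof (rule ccontr)
    assume "\<not> ?thesis"
    with k have "r \<le> card {q \<in> Q. c {p, q} = Red}"
      by simp
    then have "pointed_clique c W r"
      using that P(1) Q(1) sub mono(2)
      by (intro pointed_cliqueI[of p W "{q \<in> Q. c {p, q} = Red}" r c Blue])
        (auto intro: mono_clique_subset)
    with contra show False ..
  qed
  have blue: "card {p \<in> P. c {q, p} = Blue} \<le> k" if "q \<in> Q" for q
  proof (rule ccontr)
    assume "\<not> ?thesis"
    with k have "r \<le> card {p \<in> P. c {q, p} = Blue}"
      by simp
    then have "pointed_clique c W r"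
      using that P(1) Q(1) sub mono(1)
      by (intro pointed_cliqueI[of q W "{p \<in> P. c {q, p} = Blue}" r c Red])
        (auto intro: mono_clique_subset)
    with contra show False ..
  qed
  \<comment> \<open>\<open>S\<close> collects the red pairs seen from \<open>P\<close>,
    \<open>T\<close> the blue pairs seen from \<open>Q\<close>; after swapping \<open>T\<close> they
    cover all of \<open>P \<times> Q\<close>.\<close>
  define S T where "S = Sigma P (\<lambda>p. {q \<in> Q. c {p, q} = Red})"
    and "T = Sigma Q (\<lambda>q. {p \<in> P. c {q, p} = Blue})"
  have "P \<times> Q \<subseteq> S \<union> prod.swap ` T"
  proof
    fix z assume "z \<in> P \<times> Q"
    then obtain p q where "z = (p, q)" "p \<in> P" "q \<in> Q"
      by blast
    then show "z \<in> S \<union> prod.swap ` T"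
      by (cases "c {p, q}") (auto simp: S_def T_def insert_commute image_iff)
  qed
  moreover have "finite S" "finite T"
    using finPQ by (auto simp: S_def T_def)
  ultimately have "card (P \<times> Q) \<le> card S + card T"
    by (meson card_Un_le card_image_le card_mono finite_UnI finite_imageI le_trans add_le_mono order_refl)
  moreover have "card S \<le> 2 * r * (k)"
    using sum_bounded_above[of P "\<lambda>p. card {q \<in> Q. c {p, q} = Red}" "k"] red P(2) finPQ
    by (simp add: S_def card_SigmaI)
  moreover have "card T \<le> 2 * r * (k)"
    using sum_bounded_above[of Q "\<lambda>q. card {p \<in> P. c {q, p} = Blue}" "k"] blue Q(2) finPQ
    by (simp add: T_def card_SigmaI)
  moreover have "card (P \<times> Q) = (2 * r) * (2 * r)"
    by (simp add: card_cartesian_product P(2) Q(2))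
  ultimately have "(2 * r) * (2 * r) \<le> 2 * r * k + 2 * r * k"
    by linarith
  then show False
    by (simp add: k algebra_simps)
qed

lemma unavoidable_patterns:
  assumes "0 < r"
  obtains C where "\<And>c W. \<lbrakk>finite W; \<And>a. C < card {e \<in> [W]\<^bsup>2\<^esup>. c e = a}\<rbrakk> \<Longrightarrow>
    pointed_clique c W r \<or> planted_matching c W r"
proof -
  \<comment> \<open>Cliques of size \<open>2 * r + 1\<close> are what
    \<open>opposite_cliques_pointed\<close> requires; the two patterns are shrunk back to size
    \<open>r\<close> afterwards.\<close>
  obtain C where C: "\<And>c W a. \<lbrakk>finite W; C < card {e \<in> [W]\<^bsup>2\<^esup>. c e = a}\<rbrakk> \<Longrightarrow>
      pointed_clique c W (2 * r + 1) \<or> planted_matching c W (2 * r + 1) \<or>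
      (\<exists>B\<subseteq>W. card B = 2 * r + 1 \<and> mono_clique c a B)"
    using many_edges_pattern[of "2 * r + 1"] by blast
  show ?thesis
  proof (rule that[of C])
    fix c :: "nat set \<Rightarrow> color" and W
    assume "finite W" "\<And>a. C < card {e \<in> [W]\<^bsup>2\<^esup>. c e = a}"
    then have "pointed_clique c W (2 * r + 1) \<or> planted_matching c W (2 * r + 1) \<or>
      (\<exists>B\<subseteq>W. card B = 2 * r + 1 \<and> mono_clique c a B)" for a
      using C by blast
    then consider "pointed_clique c W (2 * r + 1)" | "planted_matching c W (2 * r + 1)"
      | A B where "A \<subseteq> W" "card A = 2 * r + 1" "mono_clique c Red A"
          "B \<subseteq> W" "card B = 2 * r + 1" "mono_clique c Blue B"
      by metis
    then show "pointed_clique c W r \<or> planted_matching c W r"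
    proof cases
      case 1
      then show ?thesis
        by (auto intro: pointed_clique_mono)
    next
      case 2
      then show ?thesis
        by (auto intro: planted_matching_mono)
    next
      case 3
      then show ?thesis
        using opposite_cliques_pointed[OF assms] by blast
    qed
  qed
qed

section \<open>The characterization\<close>

text \<open>The set \<open>F\<close> treats both parities at once: all edges for even
  \<open>k\<close>, all but the deleted edge for odd \<open>k\<close>. The resulting bound
  \<open>C\<close> depends only on the number of vertices.\<close>

lemma constant_balancing_number_sufficient:
  assumes G: "fin_graph G" and F: "F \<subseteq> edges G" "(verts G, F) \<in> family_C (2 * m)"
    and m: "num_edges G div 2 = m"
  shows "constant_balancing_number G"
proof -
  define V where "V = verts G"
  have V: "finite V" "F \<subseteq> [V]\<^bsup>2\<^esup>"
    using fin_graphD[OF G] F(1) by (auto simp: V_def)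
  have HF: "fin_graph (V, F)" "m \<le> matching_number (V, F)" "card F = 2 * m"
      "\<exists>x\<in>V. card {e \<in> F. x \<in> e} = m"
    using F(2) by (auto simp: V_def family_C_def num_edges_def degree_def verts_def edges_def)
  obtain x where x: "x \<in> V" "card {e \<in> F. x \<in> e} = m"
    using HF(4) by blast
  obtain M where "matching (V, F) M" "card M = m"
    using matching_number_ge_iff[OF HF(1)] HF(2) by blast
  then have M: "M \<subseteq> F" "pairwise disjnt M" "card M = m"
    by (auto simp: matching_def edges_def)
  have "0 < card V"
    using x(1) V(1) by (auto simp: card_gt_0_iff)
  then obtain C where C: "\<And>c W. \<lbrakk>finite W; \<And>a. C < card {e \<in> [W]\<^bsup>2\<^esup>. c e = a}\<rbrakk> \<Longrightarrow>
      pointed_clique c W (card V) \<or> planted_matching c W (card V)"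
    using unavoidable_patterns by metis
  have "has_balanced_copy n c G"
    if large: "\<And>a. C < card (color_class c (complete_graph n) a)" for n c
  proof -
    have "pointed_clique c {..<n} (card V) \<or> planted_matching c {..<n} (card V)"
      using large by (intro C) (auto simp: color_class_def complete_graph_def edges_def)
    then have "\<exists>f a. inj_on f V \<and> f ` V \<subseteq> {..<n} \<and> card {e \<in> F. c (f ` e) = a} = m"
    proof
      assume "pointed_clique c {..<n} (card V)"
      then obtain f a where f: "inj_on f V" "f ` V \<subseteq> {..<n}" "{e \<in> F. c (f ` e) \<noteq> a} = {e \<in> F. x \<in> e}"
        using embed_pointed_clique[OF V x(1)] by blast
      \<comment> \<open>The \<open>m\<close> edges at \<open>x\<close> are those of colour different
        from \<open>a\<close>, that is, of colour \<open>b\<close>.\<close>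
      obtain b where "\<And>y. y \<noteq> a \<longleftrightarrow> y = b"
        using other_color by blast
      then show ?thesis
        using f x(2) by (intro exI[of _ f] exI[of _ b]) simp
    next
      assume "planted_matching c {..<n} (card V)"
      then obtain f a where "inj_on f V" "f ` V \<subseteq> {..<n}" "{e \<in> F. c (f ` e) = a} = M"
        by (rule embed_planted_matching[OF V M(1,2)])
      then show ?thesis
        using M(3) by blast
    qed
    then show ?thesis
      using has_balanced_copyI[OF G F(1) HF(3) m] unfolding V_def by blast
  qed
  then have "bal n G \<le> enat C" for n
    unfolding bal_le_iff by blast
  then show ?thesis
    unfolding constant_balancing_number_def by blast
qed

text \<open>The edge to delete lies outside the matching, and contains \<open>x\<close> exactly if \<open>x\<close> has degree
  \<open>m + 1\<close>; at most one matching edge contains \<open>x\<close>, so a count provides such an edge.\<close>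
lemma odd_deletable_edge:
  assumes G: "fin_graph G" and k: "num_edges G = 2 * m + 1" and m: "0 < m"
    and deg: "degree G x = m \<or> degree G x = m + 1"
    and M: "matching G M" "card M = m"
  obtains e where "e \<in> edges G" "e \<notin> M" "card {e' \<in> edges G - {e}. x \<in> e'} = m"
proof -
  have finE: "finite (edges G)"
    using G by (rule fin_graphD)
  have ME: "M \<subseteq> edges G" "pairwise disjnt M"
    using M(1) by (auto simp: matching_def)
  then have finM: "finite M"
    using finE by (auto intro: finite_subset)
  define S where "S = {e \<in> edges G. x \<in> e}"
  have finS: "finite S" and SE: "S \<subseteq> edges G"
    using finE by (auto simp: S_def)
  have cS: "card S = m \<or> card S = m + 1"
    using deg by (simp add: degree_def S_def)
  have "e = e'" if "e \<in> M \<inter> S" "e' \<in> M \<inter> S" for e e'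
    using that ME(2) unfolding pairwise_def disjnt_def S_def by blast
  then have MS: "card (M \<inter> S) \<le> 1"
    using card_le_Suc0_iff_eq[of "M \<inter> S"] finM by auto
  have Diff: "{e' \<in> edges G - {e}. x \<in> e'} = S - {e}" for e
    by (auto simp: S_def)
  from cS show ?thesis
  proof
    assume "card S = m + 1"
    \<comment> \<open>There are \<open>m + 1 \<ge> 2\<close> edges at \<open>x\<close>, of which at
      most one is in \<open>M\<close>.\<close>
    then have "\<not> S \<subseteq> M \<inter> S"
      using MS m card_mono[of "M \<inter> S" S] finM by auto
    then obtain e where "e \<in> S" "e \<notin> M"
      by blast
    then show ?thesis
      using that[of e] Diff[of e] \<open>card S = m + 1\<close> finS SE by auto
  next
    assume "card S = m"
    \<comment> \<open>\<open>M\<close> and \<open>S\<close> together have at most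
      \<open>2 * m\<close> edges, one fewer than \<open>G\<close>, so some edge lies in
      neither.\<close>
    have "card (M \<union> S) + card (M \<inter> S) = 2 * m"
      using card_Un_Int[OF finM finS] M(2) \<open>card S = m\<close> by simp
    then have "card (M \<union> S) < card (edges G)"
      using k by (simp add: num_edges_def)
    then obtain e where "e \<in> edges G" "e \<notin> M" "e \<notin> S"
      using ME(1) SE by (metis Un_iff less_irrefl subsetI subset_antisym Un_subset_iff)
    then show ?thesis
      using that[of e] Diff[of e] \<open>card S = m\<close> by simp
  qed
qed

theorem theorem3p6:
  fixes k :: nat and G :: "'a graph"
  assumes "k \<ge> 2" and "fin_graph G" and "num_edges G = k"
  shows "constant_balancing_number G \<longleftrightarrow>
           (if even k then G \<in> family_C k
            else (\<exists>e\<in>edges G. del_edge G e \<in> family_C (k - 1)))"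
proof
  assume "constant_balancing_number G"
  then obtain x M where x: "x \<in> verts G" "degree G x = k div 2 \<or> degree G x = k - k div 2"
      and M: "matching G M" "card M = k div 2"
    using constant_balancing_number_necessary[OF assms(2)] assms(1,3) by metis
  show "if even k then G \<in> family_C k else \<exists>e\<in>edges G. del_edge G e \<in> family_C (k - 1)"
  proof (cases "even k")
    case True
    \<comment> \<open>For even \<open>k\<close> the two possible degrees coincide.\<close>
    then have "k - k div 2 = k div 2"
      by auto
    moreover have "k div 2 \<le> matching_number G"
      using matching_number_ge_iff[OF assms(2)] M by blast
    ultimately show ?thesis
      using True x assms by (auto simp: family_C_def)
  next
    case False
    define m where "m = k div 2"
    have km: "k = 2 * m + 1" "0 < m"
      using False assms(1) by (auto simp: m_def elim!: oddE)
    have "num_edges G = 2 * m + 1" "degree G x = m \<or> degree G x = m + 1"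
      using assms(3) x(2)[folded m_def] km(1) by simp_all
    then obtain e where e: "e \<in> edges G" "e \<notin> M" "card {e' \<in> edges G - {e}. x \<in> e'} = m"
      using odd_deletable_edge[OF assms(2) _ km(2) _ M(1) M(2)[folded m_def]] by blast
    have H: "verts (del_edge G e) = verts G" "edges (del_edge G e) = edges G - {e}"
      by (simp_all add: del_edge_def verts_def edges_def)
    have fin: "fin_graph (del_edge G e)"
      using assms(2) H by (auto simp: fin_graph_def)
    have "num_edges (del_edge G e) = 2 * m"
      using e(1) H fin_graphD(2)[OF assms(2)] assms(3) km(1) by (simp add: num_edges_def)
    moreover have "matching (del_edge G e) M"
      using M(1) e(2) H by (auto simp: matching_def)
    then have "m \<le> matching_number (del_edge G e)"
      using matching_number_ge_iff[OF fin] M(2) by (auto simp: m_def)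
    moreover have "degree (del_edge G e) x = m"
      using e(3) H by (simp add: degree_def)
    ultimately have "del_edge G e \<in> family_C (2 * m)"
      using fin x(1) H by (auto simp: family_C_def)
    then show ?thesis
      using False e(1) km(1) by auto
  qed
next
  assume R: "if even k then G \<in> family_C k else \<exists>e\<in>edges G. del_edge G e \<in> family_C (k - 1)"
  define m where "m = k div 2"
  have "\<exists>F\<subseteq>edges G. (verts G, F) \<in> family_C (2 * m)"
  proof (cases "even k")
    case True
    then show ?thesis
      using R by (auto simp: m_def verts_def edges_def)
  next
    case False
    then obtain e where "del_edge G e \<in> family_C (2 * m)"
      using R by (auto simp: m_def)
    then show ?thesis
      by (auto simp: del_edge_def)
  qed
  then show "constant_balancing_number G"
    using constant_balancing_number_sufficient[OF assms(2)] assms(3) by (auto simp: m_def)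
qed

end
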